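(* Let $T$ be a moon polyomino with $s$ rows and $t$ columns. For every $s$-tuple $\mathbf{m}=(m_1,\ldots,m_s)$ of integers, $$\sum_{F\in \mathcal{N}(T,\mathbf{m})}p^{\mathrm{ne}_2(F)}q^{\mathrm{se}_2(F)}=\sum_{F\in \mathcal{N}(T,\mathbf{m})}p^{\mathrm{se}_2(F)}q^{\mathrm{ne}_2(F)},$$ and for every $t$-tuple $\mathbf{m}=(m_1,\ldots,m_t)$ of integers, $$\sum_{F\in \mathcal{N}'(T,\mathbf{m})}p^{\mathrm{ne}_2(F)}q^{\mathrm{se}_2(F)}=\sum_{F\in \mathcal{N}'(T,\mathbf{m})}p^{\mathrm{se}_2(F)}q^{\mathrm{ne}_2(F)},$$ as identities of polynomials in the indeterminates $p,q$. That is, the joint statistic $(\mathrm{ne}_2,\mathrm{se}_2)$ is symmetrically distributed over each $\mathcal{N}(T,\mathbf{m})$ and each $\mathcal{N}'(T,\mathbf{m})$.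
   Context: A polyomino is a finite nonempty arrangement (set) of unit square cells of the square grid. It is convex if no row and no column of cells has a hole (if two cells of the same row, or of the same column, belong to it, so do all cells between them). It is intersection free if any two of its rows are comparable, i.e. one can be embedded in the other by a vertical shift (the set of columns met by one row is contained in the set of columns met by the other). A moon polyomino is a convex and intersection free polyomino. Its rows are labelled $1,\ldots,s$ from top to bottom and its columns $1,\ldots,t$ from left to right. A $01$-filling $F$ of $T$ assigns $0$ or $1$ to each cell of $T$. For $\mathbf{m}=(m_1,\ldots,m_s)$, $\mathcal{N}(T,\mathbf{m})$ is the set of $01$-fillings of $T$ with exactly $m_i$ $1$'s in row $i$ for each $i$ and at most one $1$ in each column. For $\mathbf{m}=(m_1,\ldots,m_t)$, $\mathcal{N}'(T,\mathbf{m})$ is the set of $01$-fillings of $T$ with exactly $m_i$ $1$'s in column $i$ for each $i$ and at most one $1$ in each row. An ascent (resp. descent) of $F$ is a set of two $1$'s of $F$ such that one of them is strictly above and strictly to the right (resp. strictly below and strictly to the right) of the other and the smallest rectangle of cells containing the two $1$'s is contained in $T$. $\mathrm{ne}_2(F)$ and $\mathrm{se}_2(F)$ denote the numbers of ascents and of descents of $F$. *)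

theory Defs
  imports "HOL-Library.FuncSet" "HOL-Computational_Algebra.Polynomial"
begin

text \<open>
  Cells are pairs (row, column) in matrix coordinates: the row number grows downwards, the
  column number grows to the right.  Hence a cell is strictly above another one iff its
  first component is strictly smaller.
\<close>

type_synonym cell = "nat \<times> nat"

definition row :: "cell set \<Rightarrow> nat \<Rightarrow> nat set"
  where "row T i = {j. (i, j) \<in> T}"

definition col :: "cell set \<Rightarrow> nat \<Rightarrow> nat set"
  where "col T j = {i. (i, j) \<in> T}"

definition polyomino :: "cell set \<Rightarrow> bool"
  where "polyomino T \<longleftrightarrow> finite T \<and> T \<noteq> {}"

definition convex_polyomino :: "cell set \<Rightarrow> bool"
  where "convex_polyomino T \<longleftrightarrow> polyomino T \<and>
    (\<forall>i. \<forall>j\<in>row T i. \<forall>l\<in>row T i. \<forall>k. j \<le> k \<and> k \<le> l \<longrightarrow> k \<in> row T i) \<and>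
    (\<forall>j. \<forall>h\<in>col T j. \<forall>l\<in>col T j. \<forall>k. h \<le> k \<and> k \<le> l \<longrightarrow> k \<in> col T j)"

definition intersection_free :: "cell set \<Rightarrow> bool"
  where "intersection_free T \<longleftrightarrow> (\<forall>i i'. row T i \<subseteq> row T i' \<or> row T i' \<subseteq> row T i)"

definition moon_polyomino :: "cell set \<Rightarrow> bool"
  where "moon_polyomino T \<longleftrightarrow> convex_polyomino T \<and> intersection_free T"

text \<open>
  The (nonempty) rows of \<open>T\<close> are exactly those labelled 1, ..., s, its (nonempty) columns
  exactly those labelled 1, ..., t.  The rows and the columns of a moon polyomino are
  consecutive, so this only fixes its position in the grid.
\<close>

definition has_dimensions :: "cell set \<Rightarrow> nat \<Rightarrow> nat \<Rightarrow> bool"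
  where "has_dimensions T s t \<longleftrightarrow> fst ` T = {1..s} \<and> snd ` T = {1..t}"

text \<open>Fillings are extensional, so that distinct elements differ on some cell of \<open>T\<close>.\<close>

definition fillings01 :: "cell set \<Rightarrow> (cell \<Rightarrow> nat) set"
  where "fillings01 T = T \<rightarrow>\<^sub>E {0, 1}"

definition ones :: "cell set \<Rightarrow> (cell \<Rightarrow> nat) \<Rightarrow> cell set"
  where "ones T F = {c \<in> T. F c = 1}"

text \<open>
  The prescribed numbers of 1's are integers: a negative entry gives an empty set of
  fillings.  Of a tuple \<open>m\<close> only the entries at labels of rows (resp. columns) of \<open>T\<close> matter.
\<close>

definition fillings_N :: "cell set \<Rightarrow> (nat \<Rightarrow> int) \<Rightarrow> (cell \<Rightarrow> nat) set"
  where "fillings_N T m = {F \<in> fillings01 T.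
    (\<forall>i \<in> fst ` T. int (card (row (ones T F) i)) = m i) \<and>
    (\<forall>j \<in> snd ` T. card (col (ones T F) j) \<le> 1)}"

definition fillings_N' :: "cell set \<Rightarrow> (nat \<Rightarrow> int) \<Rightarrow> (cell \<Rightarrow> nat) set"
  where "fillings_N' T m = {F \<in> fillings01 T.
    (\<forall>j \<in> snd ` T. int (card (col (ones T F) j)) = m j) \<and>
    (\<forall>i \<in> fst ` T. card (row (ones T F) i) \<le> 1)}"

definition rect_hull :: "cell \<Rightarrow> cell \<Rightarrow> cell set"
  where "rect_hull c d =
    {min (fst c) (fst d)..max (fst c) (fst d)} \<times> {min (snd c) (snd d)..max (snd c) (snd d)}"

definition ascents :: "cell set \<Rightarrow> (cell \<Rightarrow> nat) \<Rightarrow> cell set set"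
  where "ascents T F = {{c, d} | c d. c \<in> ones T F \<and> d \<in> ones T F \<and>
    fst d < fst c \<and> snd c < snd d \<and> rect_hull c d \<subseteq> T}"

definition descents :: "cell set \<Rightarrow> (cell \<Rightarrow> nat) \<Rightarrow> cell set set"
  where "descents T F = {{c, d} | c d. c \<in> ones T F \<and> d \<in> ones T F \<and>
    fst c < fst d \<and> snd c < snd d \<and> rect_hull c d \<subseteq> T}"

definition ne2 :: "cell set \<Rightarrow> (cell \<Rightarrow> nat) \<Rightarrow> nat"
  where "ne2 T F = card (ascents T F)"

definition se2 :: "cell set \<Rightarrow> (cell \<Rightarrow> nat) \<Rightarrow> nat"
  where "se2 T F = card (descents T F)"

text \<open>The two indeterminates of the polynomial ring \<open>\<int>[p][q]\<close>.\<close>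

definition indet_p :: "int poly poly"
  where "indet_p = [:[:0, 1:]:]"

definition indet_q :: "int poly poly"
  where "indet_q = [:0, 1:]"

end

theory Submission
  imports Defs
begin

text \<open>
  In a moon polyomino the rectangle spanned by two 1's lies in \<open>T\<close> iff its four corners do.
  Fix the set \<open>C\<close> of nonempty columns.  A row of minimal length is the top or the bottom row, and
  its columns belong to all other rows; so if its 1's sit in the columns \<open>S\<close> of \<open>J \<inter> C\<close>, \<open>J\<close>
  being the columns of that row, then the numbers of ascents and descents they form are the
  numbers of inversions and noninversions between \<open>S\<close> and \<open>J \<inter> C - S\<close>.  Reversing \<open>J \<inter> C\<close>
  exchanges the two numbers, and the generating function of the remaining rows depends on
  \<open>S\<close> only through its cardinality.  The statement about \<open>N'(T, m)\<close> follows by transposition.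
\<close>

section \<open>Sets of 1's, corner pairs and their generating function\<close>

text \<open>Pairs are ordered by column, so that \<open>R = (>)\<close> counts each ascent once and
  \<open>R = (<)\<close> each descent once, rows being numbered downwards.\<close>

definition corner_pairs :: "(nat \<Rightarrow> nat \<Rightarrow> bool) \<Rightarrow> cell set \<Rightarrow> cell set \<Rightarrow> (cell \<times> cell) set"
  where "corner_pairs R T A = {(c, d) \<in> A \<times> A. snd c < snd d \<and> R (fst c) (fst d) \<and>
    (fst c, snd d) \<in> T \<and> (fst d, snd c) \<in> T}"

text \<open>Prescribing the occupied columns exactly makes the family recursive: once a row takes
  the columns \<open>S\<close>, the other rows must occupy \<open>C - S\<close>. The condition on
  \<open>i\<close> covers all numbers, so the family is empty unless \<open>m\<close> vanishes
  outside the rows of \<open>T\<close>.\<close>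

definition exact_fillings :: "cell set \<Rightarrow> (nat \<Rightarrow> nat) \<Rightarrow> nat set \<Rightarrow> cell set set"
  where "exact_fillings T m C =
    {A. A \<subseteq> T \<and> inj_on snd A \<and> snd ` A = C \<and> (\<forall>i. card (row A i) = m i)}"

definition gen_fun ::
    "'a::comm_semiring_1 \<Rightarrow> 'a \<Rightarrow> cell set \<Rightarrow> (nat \<Rightarrow> nat) \<Rightarrow> nat set \<Rightarrow> 'a"
  where "gen_fun P Q T m C = (\<Sum>A\<in>exact_fillings T m C.
    P ^ card (corner_pairs (>) T A) * Q ^ card (corner_pairs (<) T A))"

definition rel_pairs :: "(nat \<Rightarrow> nat \<Rightarrow> bool) \<Rightarrow> nat set \<Rightarrow> nat set \<Rightarrow> (nat \<times> nat) set"
  where "rel_pairs R S B = {(x, y) \<in> S \<times> B. R x y}"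

text \<open>The class of shapes on which the induction runs: it contains the moon polyominoes and
  the empty set, and it is closed under deleting the top or the bottom row. The last condition is
  convexity of the columns.\<close>

definition nested_rows :: "cell set \<Rightarrow> bool"
  where "nested_rows T \<longleftrightarrow> finite T \<and> intersection_free T \<and>
    (\<forall>h k l. h \<le> k \<and> k \<le> l \<longrightarrow> row T h \<inter> row T l \<subseteq> row T k)"

lemma finite_corner_pairs: "finite A \<Longrightarrow> finite (corner_pairs R T A)"
  by (rule finite_subset[of _ "A \<times> A"]) (auto simp: corner_pairs_def)

lemma finite_exact_fillings: "finite T \<Longrightarrow> finite (exact_fillings T m C)"
  by (rule finite_subset[of _ "Pow T"]) (auto simp: exact_fillings_def)

subsection \<open>Removing the smallest row\<close>

text \<open>By column convexity every row contains the columns common to the top and the bottom row.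
  These two rows are comparable, so the common part is the whole of one of them.\<close>

lemma smallest_row_extremal:
  assumes "nested_rows T" "T \<noteq> {}"
  obtains r where "r \<in> fst ` T" "\<And>i. i \<in> fst ` T \<Longrightarrow> row T r \<subseteq> row T i"
    "(\<forall>i\<in>fst ` T. r \<le> i) \<or> (\<forall>i\<in>fst ` T. i \<le> r)"
proof -
  define lo hi where "lo = Min (fst ` T)" and "hi = Max (fst ` T)"
  have fin: "finite (fst ` T)" "fst ` T \<noteq> {}"
    using assms by (auto simp: nested_rows_def)
  have lo: "lo \<in> fst ` T" "\<And>i. i \<in> fst ` T \<Longrightarrow> lo \<le> i"
    and hi: "hi \<in> fst ` T" "\<And>i. i \<in> fst ` T \<Longrightarrow> i \<le> hi"
    using fin by (auto simp: lo_def hi_def simp del: image_is_empty)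
  have between: "row T lo \<inter> row T hi \<subseteq> row T i" if "i \<in> fst ` T" for i
    using assms lo(2) hi(2) that by (auto simp: nested_rows_def)
  consider "row T lo \<subseteq> row T hi" | "row T hi \<subseteq> row T lo"
    using assms by (auto simp: nested_rows_def intersection_free_def)
  then show thesis
  proof cases
    case 1
    then show thesis using lo between by (intro that[of lo]) auto
  next
    case 2
    then show thesis using hi between by (intro that[of hi]) auto
  qed
qed

locale smallest_row =
  fixes T :: "cell set" and r :: nat
  assumes finite_T: "finite T"
    and smallest: "\<And>i. i \<in> fst ` T \<Longrightarrow> row T r \<subseteq> row T i"
begin

definition "T' = {c \<in> T. fst c \<noteq> r}"
definition "J = row T r"

lemma finite_J: "finite J"
  by (rule finite_subset[of _ "snd ` T"]) (force simp: J_def row_def finite_T)+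

lemma J_iff: "x \<in> J \<longleftrightarrow> (r, x) \<in> T"
  by (simp add: J_def row_def)

lemma in_T_of_J: "(i, j) \<in> T \<Longrightarrow> x \<in> J \<Longrightarrow> (i, x) \<in> T"
  using smallest[of i] by (force simp: J_def row_def)

text \<open>A pair gained by adding row \<open>r\<close> joins a 1 of that row, in column
  \<open>x\<close>, to a 1 of \<open>A\<close>, in column \<open>y\<close>. The corner outside row
  \<open>r\<close> lies in \<open>T\<close> by \<open>in_T_of_J\<close>; the corner in row
  \<open>r\<close> does so iff \<open>y \<in> J\<close>. As \<open>R\<close> relates
  \<open>r\<close> in the same direction to all rows of \<open>T'\<close>, what remains is the
  comparison \<open>Q x y\<close> of columns.\<close>

lemma card_corner_pairs_insert_row:
  assumes A: "A \<subseteq> T'" and S: "S \<subseteq> J" and disj: "S \<inter> snd ` A = {}" and inj: "inj_on snd A"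
    and "\<not> R r r"
    and "(\<forall>i\<in>fst ` T'. R r i \<and> \<not> R i r) \<and> Q = (<) \<or> (\<forall>i\<in>fst ` T'. R i r \<and> \<not> R r i) \<and> Q = (>)"
  shows "card (corner_pairs R T (A \<union> {r} \<times> S)) =
    card (corner_pairs R T' A) + card (rel_pairs Q S (J \<inter> snd ` A))"
proof -
  have finA: "finite A" and finS: "finite S"
    using A S finite_T finite_J by (auto intro: finite_subset simp: T'_def)
  let ?N = "corner_pairs R T (A \<union> {r} \<times> S) - corner_pairs R T' A"
  \<comment> \<open>The column of the cell in row \<open>r\<close> comes first, whichever of the two
    cells is on the left.\<close>
  let ?f = "\<lambda>(c, d). if fst c = r then (snd c, snd d) else (snd d, snd c :: nat)"
  have rA: "(i, j) \<in> A \<Longrightarrow> i \<noteq> r \<and> (i, j) \<in> T \<and> i \<in> fst ` T' \<and> j \<in> snd ` A" for i j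
    using A by (force simp: T'_def)
  have colA: "(i, j) \<in> A \<Longrightarrow> (k, j) \<in> A \<Longrightarrow> i = k" for i j k
    using inj_onD[OF inj] by fastforce
  have order: "R r i \<and> \<not> R i r \<and> Q = (<) \<or> R i r \<and> \<not> R r i \<and> Q = (>)" if "i \<in> fst ` T'" for i
    using assms(6) that by blast
  have sub: "corner_pairs R T' A \<subseteq> corner_pairs R T (A \<union> {r} \<times> S)"
    by (auto simp: corner_pairs_def T'_def)
  have T'_iff: "(i, j) \<in> T' \<longleftrightarrow> (i, j) \<in> T \<and> i \<noteq> r" for i j
    by (auto simp: T'_def)
  \<comment> \<open>Pairs inside \<open>A\<close> have all corners outside row \<open>r\<close>,
    hence are old pairs; pairs inside row \<open>r\<close> are excluded by
    \<open>\<not> R r r\<close>.\<close>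
  have N: "?N = {(c, d). (snd c < snd d \<and> R (fst c) (fst d)) \<and>
      (c \<in> {r} \<times> S \<and> d \<in> A \<and> snd d \<in> J \<or> c \<in> A \<and> d \<in> {r} \<times> S \<and> snd c \<in> J)}"
    (is "_ = ?M")
  proof (intro equalityI subrelI)
    fix c d assume "(c, d) \<in> ?N"
    then show "(c, d) \<in> ?M"
      using rA \<open>\<not> R r r\<close> by (cases c; cases d) (auto simp: corner_pairs_def T'_iff J_iff)
  next
    fix c d assume "(c, d) \<in> ?M"
    then show "(c, d) \<in> ?N"
      using rA S by (cases c; cases d) (auto simp: corner_pairs_def T'_iff J_iff intro: in_T_of_J)
  qed
  have "bij_betw ?f ?N (rel_pairs Q S (J \<inter> snd ` A))"
    unfolding bij_betw_def
  proof
    \<comment> \<open>The cell of \<open>A\<close> is recovered from its column because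
      \<open>A\<close> has at most one cell per column.\<close>
    show "inj_on ?f ?N"
      unfolding N using rA colA by (auto simp: inj_on_def split: if_splits)
    show "?f ` ?N = rel_pairs Q S (J \<inter> snd ` A)"
    proof (intro equalityI subrelI)
      fix x y assume "(x, y) \<in> ?f ` ?N"
      then obtain i where "(i, y) \<in> A" "x \<in> S" "y \<in> J" "R r i \<and> x < y \<or> R i r \<and> y < x"
        unfolding N using rA by (auto split: if_splits)
      then show "(x, y) \<in> rel_pairs Q S (J \<inter> snd ` A)"
        using rA[of i y] order[of i] by (auto simp: rel_pairs_def)
    next
      fix x y assume xy: "(x, y) \<in> rel_pairs Q S (J \<inter> snd ` A)"
      then obtain i where i: "(i, y) \<in> A" by (auto simp: rel_pairs_def)
      have "((r, x), (i, y)) \<in> ?N \<or> ((i, y), (r, x)) \<in> ?N"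
        unfolding N using xy i order[of i] rA[OF i] by (auto simp: rel_pairs_def)
      then show "(x, y) \<in> ?f ` ?N"
        using rA[OF i] by force
    qed
  qed
  then have "card ?N = card (rel_pairs Q S (J \<inter> snd ` A))"
    by (rule bij_betw_same_card)
  moreover have "card (corner_pairs R T (A \<union> {r} \<times> S)) = card (corner_pairs R T' A) + card ?N"
    using sub finA finS
    by (metis card_Diff_subset card_mono finite_SigmaI finite_Un finite.emptyI finite.insertI
        finite_corner_pairs le_add_diff_inverse)
  ultimately show ?thesis by simp
qed

text \<open>Together with \<open>exact_fillings_remove_row\<close> this makes cutting off row
  \<open>r\<close> invertible. The entry of \<open>m\<close> at \<open>r\<close> becomes 0 because
  \<open>T'\<close> has no cell there.\<close>

lemma exact_fillings_insert_row:
  assumes "S \<subseteq> J \<inter> C" "card S = m r" "A \<in> exact_fillings T' (m(r := 0)) (C - S)"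
  shows "A \<union> {r} \<times> S \<in> exact_fillings T m C"
    "row (A \<union> {r} \<times> S) r = S" "{c \<in> A \<union> {r} \<times> S. fst c \<noteq> r} = A"
proof -
  have A: "A \<subseteq> T'" "inj_on snd A" "snd ` A = C - S" "\<And>i. card (row A i) = (m(r := 0)) i"
    using assms(3) by (auto simp: exact_fillings_def)
  show r: "row (A \<union> {r} \<times> S) r = S" "{c \<in> A \<union> {r} \<times> S. fst c \<noteq> r} = A"
    using A(1) by (auto simp: row_def T'_def)
  have "row (A \<union> {r} \<times> S) i = row A i" if "i \<noteq> r" for i
    using that by (auto simp: row_def)
  then have "card (row (A \<union> {r} \<times> S) i) = m i" for i
    using A(4)[of i] r(1) assms(2) by (cases "i = r") auto
  moreover have "A \<union> {r} \<times> S \<subseteq> T"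
    using A(1) assms(1) by (auto simp: T'_def J_iff)
  moreover have "inj_on snd (A \<union> {r} \<times> S)"
  proof (rule inj_onI)
    fix c d assume "c \<in> A \<union> {r} \<times> S" "d \<in> A \<union> {r} \<times> S" "snd c = snd d"
    moreover have "snd e \<notin> S" if "e \<in> A" for e
      using that A(3) by blast
    ultimately show "c = d"
      using inj_onD[OF A(2)] by (cases c; cases d) fastforce
  qed
  moreover have "snd ` (A \<union> {r} \<times> S) = C"
    using A(3) assms(1) by (auto simp: image_Un)
  ultimately show "A \<union> {r} \<times> S \<in> exact_fillings T m C"
    by (simp add: exact_fillings_def)
qed

lemma exact_fillings_remove_row:
  assumes "A \<in> exact_fillings T m C"
  shows "row A r \<subseteq> J \<inter> C" "card (row A r) = m r"
    "{c \<in> A. fst c \<noteq> r} \<in> exact_fillings T' (m(r := 0)) (C - row A r)"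
    "{c \<in> A. fst c \<noteq> r} \<union> {r} \<times> row A r = A"
proof -
  have A: "A \<subseteq> T" "inj_on snd A" "snd ` A = C" "\<And>i. card (row A i) = m i"
    using assms by (auto simp: exact_fillings_def)
  show "row A r \<subseteq> J \<inter> C" "card (row A r) = m r" "{c \<in> A. fst c \<noteq> r} \<union> {r} \<times> row A r = A"
    using A by (force simp: row_def J_iff)+
  have "row {c \<in> A. fst c \<noteq> r} i = (if i = r then {} else row A i)" for i
    by (auto simp: row_def)
  then have "card (row {c \<in> A. fst c \<noteq> r} i) = (m(r := 0)) i" for i
    using A(4) by simp
  moreover have "snd ` {c \<in> A. fst c \<noteq> r} = C - row A r"
  proof
    show "snd ` {c \<in> A. fst c \<noteq> r} \<subseteq> C - row A r"
    proof
      fix j assume "j \<in> snd ` {c \<in> A. fst c \<noteq> r}"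
      then obtain i where i: "(i, j) \<in> A" "i \<noteq> r" by auto
      then have "(r, j) \<notin> A" using inj_onD[OF A(2), of "(i, j)" "(r, j)"] by auto
      then show "j \<in> C - row A r" using i A(3) by (force simp: row_def)
    qed
    show "C - row A r \<subseteq> snd ` {c \<in> A. fst c \<noteq> r}"
      using A(3) by (force simp: row_def)
  qed
  ultimately show "{c \<in> A. fst c \<noteq> r} \<in> exact_fillings T' (m(r := 0)) (C - row A r)"
    using A(1,2) by (auto simp: exact_fillings_def T'_def intro: inj_on_subset)
qed

text \<open>Each filling splits into the column set \<open>S\<close> of its row \<open>r\<close> and
  a filling of \<open>T'\<close> occupying exactly \<open>C - S\<close>. If \<open>r\<close> is the
  top row, a 1 of it forms an ascent with a lower 1 to its left, so \<open>P\<close> goes with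
  \<open>(>)\<close>; if \<open>r\<close> is the bottom row, the comparisons change places.\<close>

lemma gen_fun_remove_row:
  assumes "(\<forall>i\<in>fst ` T. r \<le> i) \<and> (R, R') = ((>), (<)) \<or>
    (\<forall>i\<in>fst ` T. i \<le> r) \<and> (R, R') = ((<), (>))"
  shows "gen_fun P Q T m C = (\<Sum>S\<in>{S. S \<subseteq> J \<inter> C \<and> card S = m r}.
    P ^ card (rel_pairs R S (J \<inter> C - S)) * Q ^ card (rel_pairs R' S (J \<inter> C - S)) *
    gen_fun P Q T' (m(r := 0)) (C - S))"
proof -
  let ?X = "{S. S \<subseteq> J \<inter> C \<and> card S = m r}"
  let ?w = "\<lambda>T A. P ^ card (corner_pairs (>) T A) * Q ^ card (corner_pairs (<) T A)"
  let ?v = "\<lambda>S. P ^ card (rel_pairs R S (J \<inter> C - S)) * Q ^ card (rel_pairs R' S (J \<inter> C - S))"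
  have fin: "finite ?X"
    by (rule finite_subset[of _ "Pow J"]) (auto simp: finite_J)
  have finT': "finite T'"
    using finite_T by (simp add: T'_def)
  have weight: "?w T (A \<union> {r} \<times> S) = ?v S * ?w T' A"
    if S: "S \<in> ?X" and A: "A \<in> exact_fillings T' (m(r := 0)) (C - S)" for S A
  proof -
    \<comment> \<open>The columns of \<open>J\<close> occupied by the other rows are those of
      \<open>J \<inter> C\<close> outside \<open>S\<close>, so the contribution of row
      \<open>r\<close> depends on \<open>S\<close> alone.\<close>
    have A': "A \<subseteq> T'" "S \<inter> snd ` A = {}" "inj_on snd A" "J \<inter> snd ` A = J \<inter> C - S"
      using A by (auto simp: exact_fillings_def)
    have fst: "i \<in> fst ` T \<and> i \<noteq> r" if "i \<in> fst ` T'" for i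
      using that by (auto simp: T'_def)
    have "(\<forall>i\<in>fst ` T'. i > r) \<and> R = (>) \<and> R' = (<) \<or> (\<forall>i\<in>fst ` T'. i < r) \<and> R = (<) \<and> R' = (>)"
      using assms fst by (metis Pair_inject order_less_le)
    then have order: "(\<forall>i\<in>fst ` T'. r > i \<and> \<not> i > r) \<and> R = (<) \<or>
        (\<forall>i\<in>fst ` T'. i > r \<and> \<not> r > i) \<and> R = (>)"
      "(\<forall>i\<in>fst ` T'. r < i \<and> \<not> i < r) \<and> R' = (<) \<or>
        (\<forall>i\<in>fst ` T'. i < r \<and> \<not> r < i) \<and> R' = (>)"
      by (metis less_asym)+
    have "card (corner_pairs (>) T (A \<union> {r} \<times> S)) =
        card (corner_pairs (>) T' A) + card (rel_pairs R S (J \<inter> snd ` A))"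
      using S by (intro card_corner_pairs_insert_row A'(1-3) order) auto
    moreover have "card (corner_pairs (<) T (A \<union> {r} \<times> S)) =
        card (corner_pairs (<) T' A) + card (rel_pairs R' S (J \<inter> snd ` A))"
      using S by (intro card_corner_pairs_insert_row A'(1-3) order) auto
    ultimately show ?thesis
      by (simp add: A'(4) power_add mult_ac)
  qed
  have "gen_fun P Q T m C = (\<Sum>(S, A)\<in>(SIGMA S:?X. exact_fillings T' (m(r := 0)) (C - S)).
      ?v S * ?w T' A)"
    unfolding gen_fun_def
  proof (rule sum.reindex_bij_witness[where
        i = "\<lambda>(S, A). A \<union> {r} \<times> S" and j = "\<lambda>A. (row A r, {c \<in> A. fst c \<noteq> r})"])
    fix A assume A: "A \<in> exact_fillings T m C"
    note rem = exact_fillings_remove_row[OF A]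
    show "(case (row A r, {c \<in> A. fst c \<noteq> r}) of (S, A) \<Rightarrow> A \<union> {r} \<times> S) = A"
      using rem(4) by simp
    show "(row A r, {c \<in> A. fst c \<noteq> r}) \<in> (SIGMA S:?X. exact_fillings T' (m(r := 0)) (C - S))"
      using rem by simp
    show "(case (row A r, {c \<in> A. fst c \<noteq> r}) of (S, A) \<Rightarrow> ?v S * ?w T' A) = ?w T A"
      using weight[OF _ rem(3)] rem by simp
  next
    fix b assume "b \<in> (SIGMA S:?X. exact_fillings T' (m(r := 0)) (C - S))"
    then obtain S A where b: "b = (S, A)" "S \<subseteq> J \<inter> C" "card S = m r"
      "A \<in> exact_fillings T' (m(r := 0)) (C - S)" by auto
    note ins = exact_fillings_insert_row[where m = m, OF b(2-4)]
    show "(case b of (S, A) \<Rightarrow> A \<union> {r} \<times> S) \<in> exact_fillings T m C"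
      "(row (case b of (S, A) \<Rightarrow> A \<union> {r} \<times> S) r,
        {c \<in> case b of (S, A) \<Rightarrow> A \<union> {r} \<times> S. fst c \<noteq> r}) = b"
      using ins b(1) by auto
  qed
  also have "\<dots> = (\<Sum>S\<in>?X. \<Sum>A\<in>exact_fillings T' (m(r := 0)) (C - S). ?v S * ?w T' A)"
    by (rule sum.Sigma[symmetric]) (use fin finT' finite_exact_fillings in auto)
  finally show ?thesis
    by (simp add: gen_fun_def sum_distrib_left)
qed

text \<open>An extremal row never lies strictly between two others, so its removal leaves no gap in
  a column.\<close>

lemma nested_rows_remove_row:
  assumes "nested_rows T" "(\<forall>i\<in>fst ` T. r \<le> i) \<or> (\<forall>i\<in>fst ` T. i \<le> r)"
  shows "nested_rows T'"
proof -
  have row_T': "row T' i = (if i = r then {} else row T i)" for i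
    by (auto simp: row_def T'_def)
  have "row T' h \<inter> row T' l \<subseteq> row T' k" if hkl: "h \<le> k" "k \<le> l" for h k l
  proof
    fix j assume j: "j \<in> row T' h \<inter> row T' l"
    then have T: "(h, j) \<in> T" "(l, j) \<in> T" "h \<noteq> r" "l \<noteq> r"
      by (auto simp: row_def T'_def)
    then have "h \<in> fst ` T" "l \<in> fst ` T" by force+
    then have "k \<noteq> r" using assms(2) hkl T by fastforce
    moreover have "j \<in> row T k"
      using assms(1) hkl T by (auto simp: nested_rows_def row_def)
    ultimately show "j \<in> row T' k" by (simp add: row_T')
  qed
  moreover have "finite T'" using finite_T by (simp add: T'_def)
  ultimately show ?thesis
    using assms(1) by (auto simp: nested_rows_def intersection_free_def row_T')
qed

end

subsection \<open>Symmetry of the generating function\<close>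

text \<open>Induction by adding a new maximum \<open>b\<close> to the domain: it goes to the minimum
  \<open>a\<close> of the target, below all other images.\<close>

lemma ex_antimono_bij_betw:
  fixes A B :: "nat set"
  assumes "finite A" "finite B" "card A = card B"
  obtains g where "bij_betw g A B" "\<And>x y. x \<in> A \<Longrightarrow> y \<in> A \<Longrightarrow> x < y \<longleftrightarrow> g y < g x"
proof -
  have "\<exists>g. bij_betw g A B \<and> (\<forall>x\<in>A. \<forall>y\<in>A. x < y \<longrightarrow> g y < g x)"
    using assms
  proof (induction A arbitrary: B rule: finite_linorder_max_induct)
    case empty
    then show ?case by auto
  next
    case (insert b A)
    then have B: "B \<noteq> {}" "finite B" by auto
    define a where "a = Min B"
    have a: "a \<in> B" "\<And>x. x \<in> B - {a} \<Longrightarrow> a < x"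
      using B by (auto simp: a_def less_le)
    have bA: "b \<notin> A" using insert by auto
    have "card A = card (B - {a})"
      using insert.hyps(1) insert.prems(2) bA a(1) by simp
    then obtain g where g: "bij_betw g A (B - {a})" "\<And>x y. x \<in> A \<Longrightarrow> y \<in> A \<Longrightarrow> x < y \<Longrightarrow> g y < g x"
      using insert.IH[of "B - {a}"] B by auto
    have img: "g x \<in> B - {a}" if "x \<in> A" for x
      using g(1) that by (auto simp: bij_betw_def)
    have "bij_betw (g(b := a)) A (B - {a})"
      using g(1) bA by (subst bij_betw_cong[of A _ g]) auto
    then have "bij_betw (g(b := a)) (insert b A) (insert a (B - {a}))"
      using bij_betw_combine[of "g(b := a)" A "B - {a}" "{b}" "{a}"] by (simp add: bij_betw_def)
    moreover have "insert a (B - {a}) = B" using a by auto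
    moreover have "(g(b := a)) y < (g(b := a)) x"
      if "x \<in> insert b A" "y \<in> insert b A" "x < y" for x y
      using that insert.hyps(2) g(2) a(2) img bA by (auto dest: less_asym)
    ultimately show ?case by (metis (no_types))
  qed
  then obtain g where g: "bij_betw g A B" "\<And>x y. x \<in> A \<Longrightarrow> y \<in> A \<Longrightarrow> x < y \<Longrightarrow> g y < g x"
    by blast
  have "x < y \<longleftrightarrow> g y < g x" if "x \<in> A" "y \<in> A" for x y
    using g(2)[OF that] g(2)[OF that(2,1)] by (metis less_asym linorder_neqE_nat less_irrefl)
  with g(1) show thesis using that by blast
qed

lemma card_rel_pairs_image:
  assumes "inj_on g K" "S \<subseteq> K" "B \<subseteq> K" "\<And>x y. x \<in> K \<Longrightarrow> y \<in> K \<Longrightarrow> R x y \<longleftrightarrow> R' (g x) (g y)"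
  shows "card (rel_pairs R' (g ` S) (g ` B)) = card (rel_pairs R S B)"
proof -
  have "bij_betw (map_prod g g) (rel_pairs R S B) (rel_pairs R' (g ` S) (g ` B))"
    unfolding bij_betw_def
  proof
    show "inj_on (map_prod g g) (rel_pairs R S B)"
      using assms(2,3) by (auto simp: inj_on_def rel_pairs_def dest!: inj_onD[OF assms(1)])
    show "map_prod g g ` rel_pairs R S B = rel_pairs R' (g ` S) (g ` B)"
      using assms(2-4) by (fastforce simp: rel_pairs_def)
  qed
  then show ?thesis by (metis bij_betw_same_card)
qed

text \<open>Two column sets are needed for the induction on the number of rows: reversing the
  columns of the smallest row replaces \<open>S\<close> by its image under \<open>g\<close>, so
  different columns are left over on the two sides. The hypothesis on rows survives because the
  removed sets have equal size and lie in \<open>J\<close>, hence in every remaining row.\<close>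

theorem gen_fun_symmetric:
  assumes "nested_rows T" "finite C" "finite C'" "card C = card C'"
    and "\<And>i. card (row T i \<inter> C) = card (row T i \<inter> C')"
  shows "gen_fun P Q T m C = gen_fun Q P T m C'"
  using assms
proof (induction "card (fst ` T)" arbitrary: T m C C' rule: less_induct)
  case less
  show ?case
  proof (cases "T = {}")
    case True
    \<comment> \<open>Without cells only the empty column set can be occupied, so it suffices that
      \<open>C\<close> and \<open>C'\<close> are empty simultaneously.\<close>
    have "C = {} \<longleftrightarrow> C' = {}" using less.prems by (metis card_0_eq)
    then have "exact_fillings {} m C = exact_fillings {} m C'"
      by (auto simp: exact_fillings_def)
    moreover have "corner_pairs R {} A = {}" for R A
      by (auto simp: corner_pairs_def)
    ultimately show ?thesis
      by (simp add: True gen_fun_def)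
  next
    case False
    obtain r where r: "r \<in> fst ` T" "\<And>i. i \<in> fst ` T \<Longrightarrow> row T r \<subseteq> row T i"
      "(\<forall>i\<in>fst ` T. r \<le> i) \<or> (\<forall>i\<in>fst ` T. i \<le> r)"
      using smallest_row_extremal[OF less.prems(1) False] by blast
    have finT: "finite T" using less.prems(1) by (simp add: nested_rows_def)
    interpret smallest_row T r
      by standard (use r finT in auto)
    \<comment> \<open>\<open>R\<close> is the comparison counted by \<open>P\<close> in row
      \<open>r\<close>, and \<open>R'\<close> the one counted by \<open>Q\<close>.\<close>
    define R R' :: "nat \<Rightarrow> nat \<Rightarrow> bool"
      where "R = (if \<forall>i\<in>fst ` T. r \<le> i then (>) else (<))"
        and "R' = (if \<forall>i\<in>fst ` T. r \<le> i then (<) else (>))"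
    have R: "(\<forall>i\<in>fst ` T. r \<le> i) \<and> (R, R') = ((>), (<)) \<or>
        (\<forall>i\<in>fst ` T. i \<le> r) \<and> (R, R') = ((<), (>))"
      using r(3) by (auto simp: R_def R'_def)
    have "card (J \<inter> C) = card (J \<inter> C')"
      using less.prems(5) by (simp add: J_def)
    then obtain g where g: "bij_betw g (J \<inter> C) (J \<inter> C')"
      "\<And>x y. x \<in> J \<inter> C \<Longrightarrow> y \<in> J \<inter> C \<Longrightarrow> x < y \<longleftrightarrow> g y < g x"
      using ex_antimono_bij_betw[of "J \<inter> C" "J \<inter> C'"] finite_J by blast
    have inj: "inj_on g (J \<inter> C)" and img: "g ` (J \<inter> C) = J \<inter> C'"
      using g(1) by (auto simp: bij_betw_def)
    \<comment> \<open>Reversing the order exchanges \<open>R\<close> and \<open>R'\<close>, hence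
      the exponents that row \<open>r\<close> gives to \<open>P\<close> and
      \<open>Q\<close>.\<close>
    have gR: "R x y \<longleftrightarrow> R' (g x) (g y)" "R' x y \<longleftrightarrow> R (g x) (g y)"
      if "x \<in> J \<inter> C" "y \<in> J \<inter> C" for x y
      using g(2)[OF that] g(2)[OF that(2,1)] by (auto simp: R_def R'_def)
    let ?X = "\<lambda>C. {S. S \<subseteq> J \<inter> C \<and> card S = m r}"
    have bij: "bij_betw ((`) g) (?X C) (?X C')"
      unfolding bij_betw_def
    proof
      show "inj_on ((`) g) (?X C)"
        using inj_on_image_Pow[OF inj] by (rule inj_on_subset) auto
      show "(`) g ` ?X C = ?X C'"
      proof (intro equalityI subsetI)
        fix S assume "S \<in> (`) g ` ?X C"
        then show "S \<in> ?X C'"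
          using img inj by (auto simp: card_image inj_on_subset)
      next
        fix S assume S: "S \<in> ?X C'"
        then obtain U where U: "U \<subseteq> J \<inter> C" "S = g ` U"
          using subset_imageE[of S g "J \<inter> C"] img by auto
        then show "S \<in> (`) g ` ?X C"
          using S inj by (auto simp: card_image inj_on_subset)
      qed
    qed
    have smaller: "card (fst ` T') < card (fst ` T)"
    proof (rule psubset_card_mono)
      show "finite (fst ` T)" using finT by simp
      show "fst ` T' \<subset> fst ` T" using r(1) by (auto simp: T'_def)
    qed
    have IH: "gen_fun P Q T' (m(r := 0)) (C - S) = gen_fun Q P T' (m(r := 0)) (C' - g ` S)"
      if S: "S \<in> ?X C" for S
    proof (rule less.hyps[OF smaller nested_rows_remove_row[OF less.prems(1) r(3)]])
      have S': "g ` S \<subseteq> J \<inter> C'" "card (g ` S) = card S" "finite S"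
        using S img inj finite_J by (auto simp: card_image inj_on_subset intro: finite_subset)
      show "finite (C - S)" "finite (C' - g ` S)" using less.prems by auto
      have "card (C - S) = card C - card S"
        using S S' by (intro card_Diff_subset) auto
      moreover have "card (C' - g ` S) = card C' - card (g ` S)"
        using S' by (intro card_Diff_subset) auto
      ultimately show "card (C - S) = card (C' - g ` S)"
        using less.prems(4) S'(2) by simp
      fix i
      show "card (row T' i \<inter> (C - S)) = card (row T' i \<inter> (C' - g ` S))"
      proof (cases "i \<in> fst ` T'")
        case True
        then have "row T' i = row T i" "J \<subseteq> row T i"
          using r(2)[of i] by (auto simp: T'_def row_def J_def)
        moreover from this have "card (row T i \<inter> C - S) = card (row T i \<inter> C) - card S"
          using S S' by (intro card_Diff_subset) auto
        moreover from calculation have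
          "card (row T i \<inter> C' - g ` S) = card (row T i \<inter> C') - card (g ` S)"
          using S' by (intro card_Diff_subset) auto
        ultimately show ?thesis
          using less.prems(5)[of i] S'(2) by (simp add: Int_Diff)
      next
        case False
        then have "row T' i = {}" by (force simp: row_def)
        then show ?thesis by simp
      qed
    qed
    \<comment> \<open>Term by term, the contribution of \<open>S\<close> equals that of its image
      with \<open>P\<close> and \<open>Q\<close> exchanged.\<close>
    have "gen_fun P Q T m C = (\<Sum>S\<in>?X C.
        Q ^ card (rel_pairs R (g ` S) (J \<inter> C' - g ` S)) *
        P ^ card (rel_pairs R' (g ` S) (J \<inter> C' - g ` S)) *
        gen_fun Q P T' (m(r := 0)) (C' - g ` S))"
      unfolding gen_fun_remove_row[OF R, where m = m]
    proof (rule sum.cong[OF refl])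
      fix S assume S: "S \<in> ?X C"
      then have SK: "S \<subseteq> J \<inter> C" by auto
      have B: "J \<inter> C' - g ` S = g ` (J \<inter> C - S)"
        using img SK inj by (metis inj_on_image_set_diff Diff_subset)
      have "card (rel_pairs R' (g ` S) (J \<inter> C' - g ` S)) = card (rel_pairs R S (J \<inter> C - S))"
        unfolding B by (rule card_rel_pairs_image[where K = "J \<inter> C"]) (use inj SK gR(1) in auto)
      moreover have "card (rel_pairs R (g ` S) (J \<inter> C' - g ` S)) = card (rel_pairs R' S (J \<inter> C - S))"
        unfolding B by (rule card_rel_pairs_image[where K = "J \<inter> C"]) (use inj SK gR(2) in auto)
      ultimately show "P ^ card (rel_pairs R S (J \<inter> C - S)) * Q ^ card (rel_pairs R' S (J \<inter> C - S)) *
          gen_fun P Q T' (m(r := 0)) (C - S) =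
        Q ^ card (rel_pairs R (g ` S) (J \<inter> C' - g ` S)) *
        P ^ card (rel_pairs R' (g ` S) (J \<inter> C' - g ` S)) *
        gen_fun Q P T' (m(r := 0)) (C' - g ` S)"
        using IH[OF S] by (simp add: mult_ac)
    qed
    also have "\<dots> = gen_fun Q P T m C'"
      unfolding gen_fun_remove_row[OF R, where m = m]
      by (rule sum.reindex_bij_betw[OF bij])
    finally show ?thesis .
  qed
qed

subsection \<open>Fillings as sets of cells\<close>

definition ones_N :: "cell set \<Rightarrow> (nat \<Rightarrow> int) \<Rightarrow> cell set set"
  where "ones_N T m = {A. A \<subseteq> T \<and> (\<forall>i\<in>fst ` T. int (card (row A i)) = m i) \<and>
    (\<forall>j\<in>snd ` T. card (col A j) \<le> 1)}"

lemma nested_rows_moon: "moon_polyomino T \<Longrightarrow> nested_rows T"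
  unfolding moon_polyomino_def convex_polyomino_def polyomino_def nested_rows_def row_def col_def
  by blast

lemma inj_on_snd_iff_card_col:
  assumes "finite A" "A \<subseteq> T"
  shows "inj_on snd A \<longleftrightarrow> (\<forall>j\<in>snd ` T. card (col A j) \<le> 1)"
proof -
  have "finite (col A j)" for j
    by (rule finite_subset[of _ "fst ` A"]) (use assms in \<open>force simp: col_def\<close>)+
  then have "(\<forall>j\<in>snd ` T. card (col A j) \<le> 1) \<longleftrightarrow>
      (\<forall>j\<in>snd ` T. \<forall>i\<in>col A j. \<forall>i'\<in>col A j. i = i')"
    by (simp add: card_le_Suc0_iff_eq)
  also have "\<dots> \<longleftrightarrow> inj_on snd A"
    using assms(2) by (force simp: inj_on_def col_def)
  finally show ?thesis by simp
qed

text \<open>The sets are sorted by the columns \<open>C\<close> that they occupy. Each class is an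
  \<open>exact_fillings T n C\<close>, on which \<open>gen_fun_symmetric\<close> with
  \<open>C' = C\<close> exchanges \<open>P\<close> and \<open>Q\<close>.\<close>

lemma ones_N_symmetric:
  fixes P Q :: "'a::comm_semiring_1"
  assumes "moon_polyomino T"
  shows "(\<Sum>A\<in>ones_N T m. P ^ card (corner_pairs (>) T A) * Q ^ card (corner_pairs (<) T A)) =
    (\<Sum>A\<in>ones_N T m. P ^ card (corner_pairs (<) T A) * Q ^ card (corner_pairs (>) T A))"
proof (cases "\<forall>i\<in>fst ` T. 0 \<le> m i")
  case False
  \<comment> \<open>A negative entry is not a cardinality.\<close>
  then have "ones_N T m = {}" by (force simp: ones_N_def)
  then show ?thesis by simp
next
  case True
  have nested: "nested_rows T" and fin: "finite T"
    using nested_rows_moon[OF assms] by (auto simp: nested_rows_def)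
  \<comment> \<open>\<open>exact_fillings\<close> constrains every row number, so \<open>n\<close>
    has to be 0 outside the rows of \<open>T\<close>.\<close>
  define n where "n i = (if i \<in> fst ` T then nat (m i) else 0)" for i
  have row_iff: "(\<forall>i\<in>fst ` T. int (card (row A i)) = m i) \<longleftrightarrow> (\<forall>i. card (row A i) = n i)"
    if "A \<subseteq> T" for A
  proof -
    have "card (row A i) = 0" if "i \<notin> fst ` T" for i
    proof -
      have "row A i = {}" using that \<open>A \<subseteq> T\<close> by (force simp: row_def)
      then show ?thesis by simp
    qed
    then have "(\<forall>i. card (row A i) = n i) \<longleftrightarrow> (\<forall>i\<in>fst ` T. card (row A i) = nat (m i))"
      unfolding n_def by metis
    moreover have "int (card (row A i)) = m i \<longleftrightarrow> card (row A i) = nat (m i)" if "i \<in> fst ` T" for i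
      using bspec[OF True that] by linarith
    ultimately show ?thesis by simp
  qed
  have fibre: "{A \<in> ones_N T m. snd ` A = C} = exact_fillings T n C" for C
  proof -
    have "A \<in> ones_N T m \<and> snd ` A = C \<longleftrightarrow> A \<in> exact_fillings T n C" for A
    proof (cases "A \<subseteq> T")
      case True
      then have "finite A" using fin by (rule finite_subset)
      then show ?thesis
        unfolding ones_N_def exact_fillings_def mem_Collect_eq row_iff[OF True]
          inj_on_snd_iff_card_col[OF \<open>finite A\<close> True] by blast
    qed (auto simp: ones_N_def exact_fillings_def)
    then show ?thesis by blast
  qed
  have finN: "finite (ones_N T m)"
    by (rule finite_subset[of _ "Pow T"]) (auto simp: ones_N_def fin)
  have by_columns: "sum f (ones_N T m) = (\<Sum>C\<in>Pow (snd ` T). sum f (exact_fillings T n C))"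
    for f :: "cell set \<Rightarrow> 'a"
  proof -
    have "(\<Sum>C\<in>Pow (snd ` T). sum f {A \<in> ones_N T m. snd ` A = C}) = sum f (ones_N T m)"
      by (rule sum.group) (use fin finN in \<open>auto simp: ones_N_def\<close>)
    then show ?thesis by (simp add: fibre)
  qed
  \<comment> \<open>As written, both sides of this equation are the same sum. The exchange asserted
    by the lemma corresponds to \<open>gen_fun Q P T n C\<close> on the right, the case
    \<open>C' = C\<close> of \<open>gen_fun_symmetric\<close>.\<close>
  have "(\<Sum>C\<in>Pow (snd ` T). gen_fun P Q T n C) = (\<Sum>C\<in>Pow (snd ` T). gen_fun Q P T n C)"
    by (intro sum.cong gen_fun_symmetric nested) (use fin in \<open>auto intro: finite_subset\<close>)
  then show ?thesis
    by (simp add: by_columns gen_fun_def mult.commute)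
qed

section \<open>Ascents and descents as corner pairs\<close>

text \<open>Column convexity fills the two vertical sides of the rectangle; row convexity then fills
  each row between them.\<close>

lemma rect_hull_subset_iff:
  assumes "convex_polyomino T" "c \<in> T" "d \<in> T"
  shows "rect_hull c d \<subseteq> T \<longleftrightarrow> (fst c, snd d) \<in> T \<and> (fst d, snd c) \<in> T"
proof
  assume "rect_hull c d \<subseteq> T"
  then show "(fst c, snd d) \<in> T \<and> (fst d, snd c) \<in> T"
    by (auto simp: rect_hull_def)
next
  assume corners: "(fst c, snd d) \<in> T \<and> (fst d, snd c) \<in> T"
  have rows: "(i, k) \<in> T" if "(i, j) \<in> T" "(i, l) \<in> T" "j \<le> k" "k \<le> l" for i j k l
    using assms(1) that unfolding convex_polyomino_def row_def by blast
  have cols: "(k, j) \<in> T" if "(h, j) \<in> T" "(l, j) \<in> T" "h \<le> k" "k \<le> l" for j h k l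
    using assms(1) that unfolding convex_polyomino_def col_def by blast
  show "rect_hull c d \<subseteq> T"
  proof (rule subrelI)
    fix i j assume "(i, j) \<in> rect_hull c d"
    then have ij: "min (fst c) (fst d) \<le> i" "i \<le> max (fst c) (fst d)"
      "min (snd c) (snd d) \<le> j" "j \<le> max (snd c) (snd d)"
      by (auto simp: rect_hull_def)
    have "(i, snd c) \<in> T" "(i, snd d) \<in> T"
      using ij(1,2) cols[of "fst c" _ "fst d" i] cols[of "fst d" _ "fst c" i] corners assms(2,3)
      by (auto simp: min_def max_def split: if_splits)
    then show "(i, j) \<in> T"
      using ij(3,4) rows[of i "snd c" "snd d" j] rows[of i "snd d" "snd c" j]
      by (auto simp: min_def max_def split: if_splits)
  qed
qed

text \<open>The strict order of the columns tells which element of a doubleton comes first, so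
  forgetting the order loses nothing.\<close>

lemma card_corner_doubletons:
  "card {{c, d} | c d. (c, d) \<in> corner_pairs R T A} = card (corner_pairs R T A)"
proof -
  have "inj_on (\<lambda>(c, d). {c, d}) (corner_pairs R T A)"
    by (auto simp: inj_on_def corner_pairs_def doubleton_eq_iff)
  moreover have "{{c, d} | c d. (c, d) \<in> corner_pairs R T A} =
      (\<lambda>(c, d). {c, d}) ` corner_pairs R T A"
    by (auto simp: image_def)
  ultimately show ?thesis by (simp add: card_image)
qed

lemma ne2_eq_card_corner_pairs:
  assumes "convex_polyomino T"
  shows "ne2 T F = card (corner_pairs (>) T (ones T F))"
proof -
  have "(c, d) \<in> corner_pairs (>) T (ones T F) \<longleftrightarrow> c \<in> ones T F \<and> d \<in> ones T F \<and>
      fst d < fst c \<and> snd c < snd d \<and> rect_hull c d \<subseteq> T" for c d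
    using rect_hull_subset_iff[OF assms, of c d] by (simp add: corner_pairs_def ones_def) blast
  then have "ascents T F = {{c, d} | c d. (c, d) \<in> corner_pairs (>) T (ones T F)}"
    by (simp add: ascents_def)
  then show ?thesis
    unfolding ne2_def by (simp only: card_corner_doubletons)
qed

lemma se2_eq_card_corner_pairs:
  assumes "convex_polyomino T"
  shows "se2 T F = card (corner_pairs (<) T (ones T F))"
proof -
  have "(c, d) \<in> corner_pairs (<) T (ones T F) \<longleftrightarrow> c \<in> ones T F \<and> d \<in> ones T F \<and>
      fst c < fst d \<and> snd c < snd d \<and> rect_hull c d \<subseteq> T" for c d
    using rect_hull_subset_iff[OF assms, of c d] by (simp add: corner_pairs_def ones_def) blast
  then have "descents T F = {{c, d} | c d. (c, d) \<in> corner_pairs (<) T (ones T F)}"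
    by (simp add: descents_def)
  then show ?thesis
    unfolding se2_def by (simp only: card_corner_doubletons)
qed

text \<open>The inverse is the indicator function restricted to \<open>T\<close>; fillings are
  extensional, so they are determined by their 1's.\<close>

lemma bij_betw_ones: "bij_betw (ones T) (fillings01 T) (Pow T)"
proof (rule bij_betw_byWitness[where f' = "\<lambda>A. \<lambda>c\<in>T. if c \<in> A then 1 else 0"])
  show "\<forall>F\<in>fillings01 T. (\<lambda>c\<in>T. if c \<in> ones T F then 1 else 0) = F"
    by (fastforce simp: fillings01_def ones_def PiE_iff extensional_def)
  show "\<forall>A\<in>Pow T. ones T (\<lambda>c\<in>T. if c \<in> A then 1 else 0) = A"
    by (auto simp: ones_def split: if_splits)
  show "ones T ` fillings01 T \<subseteq> Pow T" by (auto simp: ones_def)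
  show "(\<lambda>A. \<lambda>c\<in>T. if c \<in> A then 1 else 0) ` Pow T \<subseteq> fillings01 T"
    by (auto simp: fillings01_def split: if_splits)
qed

lemma bij_betw_Collect:
  assumes "bij_betw f A B"
  shows "bij_betw f {x \<in> A. P (f x)} {y \<in> B. P y}"
  using assms by (auto simp: bij_betw_def inj_on_def)

lemma bij_betw_fillings_N: "bij_betw (ones T) (fillings_N T m) (ones_N T m)"
  using bij_betw_Collect[OF bij_betw_ones, of T "\<lambda>A. (\<forall>i\<in>fst ` T. int (card (row A i)) = m i) \<and>
    (\<forall>j\<in>snd ` T. card (col A j) \<le> 1)"]
  by (simp add: fillings_N_def ones_N_def)

subsection \<open>Transposition\<close>

lemma swap_image_iff [simp]: "(i, j) \<in> prod.swap ` T \<longleftrightarrow> (j, i) \<in> T"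
  by force

lemma row_swap_image: "row (prod.swap ` T) j = col T j"
  and col_swap_image: "col (prod.swap ` T) i = row T i"
  by (simp_all add: row_def col_def)

text \<open>Two incomparable columns \<open>j\<close> and \<open>j'\<close> would contain cells
  \<open>(h, j)\<close> and \<open>(k, j')\<close> whose opposite corners are missing, and then the
  rows \<open>h\<close> and \<open>k\<close> would be incomparable as well.\<close>

lemma moon_polyomino_swap:
  assumes "moon_polyomino T"
  shows "moon_polyomino (prod.swap ` T)"
proof -
  have free: "row T i \<subseteq> row T i' \<or> row T i' \<subseteq> row T i" for i i'
    using assms by (simp add: moon_polyomino_def intersection_free_def)
  have "col T j \<subseteq> col T j' \<or> col T j' \<subseteq> col T j" for j j'
  proof (rule ccontr)
    assume "\<not> ?thesis"
    then obtain h k where "(h, j) \<in> T" "(h, j') \<notin> T" "(k, j') \<in> T" "(k, j) \<notin> T"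
      by (auto simp: col_def)
    then show False using free[of h k] by (auto simp: row_def)
  qed
  then have "intersection_free (prod.swap ` T)"
    by (simp add: intersection_free_def row_swap_image)
  moreover have "convex_polyomino (prod.swap ` T)"
  proof -
    have "polyomino (prod.swap ` T) \<longleftrightarrow> polyomino T"
      by (auto simp: polyomino_def dest: finite_imageD)
    then show ?thesis
      using assms unfolding moon_polyomino_def convex_polyomino_def row_swap_image col_swap_image
      by (elim conjE) (intro conjI, rule iffD2)
  qed
  ultimately show ?thesis by (simp add: moon_polyomino_def)
qed

text \<open>Reflection in the main diagonal keeps the upper left cell of a descent upper left, but
  makes the lower left cell of an ascent the upper right one. The second bijection therefore also
  reverses the pair.\<close>

lemma card_corner_pairs_swap:
  "card (corner_pairs (<) (prod.swap ` T) (prod.swap ` A)) = card (corner_pairs (<) T A)"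
  "card (corner_pairs (>) (prod.swap ` T) (prod.swap ` A)) = card (corner_pairs (>) T A)"
proof -
  show "card (corner_pairs (<) (prod.swap ` T) (prod.swap ` A)) = card (corner_pairs (<) T A)"
    by (rule bij_betw_same_card, rule bij_betw_byWitness[where f = "map_prod prod.swap prod.swap"
          and f' = "map_prod prod.swap prod.swap"])
      (auto simp: corner_pairs_def)
  show "card (corner_pairs (>) (prod.swap ` T) (prod.swap ` A)) = card (corner_pairs (>) T A)"
    by (rule bij_betw_same_card, rule bij_betw_byWitness[where
          f = "\<lambda>(c, d). (prod.swap d, prod.swap c)" and f' = "\<lambda>(c, d). (prod.swap d, prod.swap c)"])
      (auto simp: corner_pairs_def)
qed

lemma bij_betw_fillings_N':
  "bij_betw (\<lambda>F. prod.swap ` ones T F) (fillings_N' T m) (ones_N (prod.swap ` T) m)"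
proof -
  have "bij_betw ((`) prod.swap) (Pow T) (Pow (prod.swap ` T))"
    by (rule bij_betw_Pow) (simp add: bij_betw_def)
  then have bij: "bij_betw (\<lambda>F. prod.swap ` ones T F) (fillings01 T) (Pow (prod.swap ` T))"
    using bij_betw_trans[OF bij_betw_ones[of T]] by (simp add: comp_def)
  have "fst ` prod.swap ` T = snd ` T" "snd ` prod.swap ` T = fst ` T"
    by (simp_all add: image_image)
  then show ?thesis
    using bij_betw_Collect[OF bij, of "\<lambda>A. (\<forall>i\<in>snd ` T. int (card (row A i)) = m i) \<and>
      (\<forall>j\<in>fst ` T. card (col A j) \<le> 1)"]
    by (simp add: fillings_N'_def ones_N_def row_swap_image col_swap_image)
qed

section \<open>The two symmetry identities\<close>

theorem theorem1p2:
  fixes T :: "cell set" and s t :: nat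
  assumes "moon_polyomino T" and "has_dimensions T s t"
  shows "(\<forall>m :: nat \<Rightarrow> int.
            (\<Sum>F\<in>fillings_N T m. indet_p ^ ne2 T F * indet_q ^ se2 T F) =
            (\<Sum>F\<in>fillings_N T m. indet_p ^ se2 T F * indet_q ^ ne2 T F)) \<and>
         (\<forall>m :: nat \<Rightarrow> int.
            (\<Sum>F\<in>fillings_N' T m. indet_p ^ ne2 T F * indet_q ^ se2 T F) =
            (\<Sum>F\<in>fillings_N' T m. indet_p ^ se2 T F * indet_q ^ ne2 T F))"
proof -
  have convex: "convex_polyomino T"
    using assms(1) by (simp add: moon_polyomino_def)
  note stats = ne2_eq_card_corner_pairs[OF convex] se2_eq_card_corner_pairs[OF convex]
  have "(\<Sum>F\<in>fillings_N T m. indet_p ^ ne2 T F * indet_q ^ se2 T F) =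
      (\<Sum>F\<in>fillings_N T m. indet_p ^ se2 T F * indet_q ^ ne2 T F)" for m
    using ones_N_symmetric[OF assms(1), of indet_p indet_q m]
    unfolding stats sum.reindex_bij_betw[OF bij_betw_fillings_N, symmetric] .
  \<comment> \<open>Transposition preserves both statistics, so this is the row version for the
    transposed polyomino.\<close>
  moreover have "(\<Sum>F\<in>fillings_N' T m. indet_p ^ ne2 T F * indet_q ^ se2 T F) =
      (\<Sum>F\<in>fillings_N' T m. indet_p ^ se2 T F * indet_q ^ ne2 T F)" for m
    using ones_N_symmetric[OF moon_polyomino_swap[OF assms(1)], of indet_p indet_q m]
    unfolding stats sum.reindex_bij_betw[OF bij_betw_fillings_N', symmetric]
      card_corner_pairs_swap .
  ultimately show ?thesis by blast
qed

end
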